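(* Let $(X,T)$ be a transitive cascade. (1) If $X$ is not connected, then its enveloping semigroup, as a dynamical system $(E(X,T),T_* )$, is not weakly mixing. (2) If $X$ admits a nonempty proper, isolated, closed, invariant subset, then its enveloping semigroup, as a dynamical system $(E(X,T),T_* )$, is not weakly mixing.
   Context: A cascade $(X,T)$ is a homeomorphism $T$ of a compact Hausdorff space $X$ (not necessarily metrizable). A subset $A\subset X$ is invariant if $T(A)=A$. A cascade $(Y,S)$ is transitive if for all nonempty open $U,V\subset Y$ there is $i\in\mathbb{Z}$ with $U\cap S^{-i}(V)\neq\emptyset$; it is weakly mixing if $(Y\times Y,S\times S)$ is transitive. The enveloping semigroup $E(X,T)$ is the closure of $\{T^i : i \in \mathbb{Z}\}$ in $X^X$ (product topology), regarded as a cascade under the homeomorphism $T_* : p \mapsto T\circ p$. An invariant subset $A\subset X$ is isolated if there is a closed set $U\subset X$ containing $A$ in its interior such that $A=\bigcap_{n\in\mathbb{Z}}T^n(U)$ (equivalently, $A$ is the maximum closed invariant subset of $U$). Not connected means being the union of two disjoint nonempty open subsets. *)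

theory Defs
  imports "HOL-Analysis.Analysis"
begin

definition cascade :: "'a topology \<Rightarrow> ('a \<Rightarrow> 'a) \<Rightarrow> bool" where
  "cascade X T \<longleftrightarrow> compact_space X \<and> Hausdorff_space X \<and> homeomorphic_map X X T"

text \<open>Only the values of \<open>T\<close> on \<open>topspace X\<close> are meaningful, so the inverse used for
  negative exponents is the inverse on \<open>topspace X\<close>.\<close>

definition iter :: "'a topology \<Rightarrow> ('a \<Rightarrow> 'a) \<Rightarrow> int \<Rightarrow> 'a \<Rightarrow> 'a" where
  "iter X T i = (if 0 \<le> i then T ^^ nat i else inv_into (topspace X) T ^^ nat (- i))"

definition invariant_subset :: "'a topology \<Rightarrow> ('a \<Rightarrow> 'a) \<Rightarrow> 'a set \<Rightarrow> bool" where
  "invariant_subset X T A \<longleftrightarrow> A \<subseteq> topspace X \<and> T ` A = A"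

definition isolated_subset :: "'a topology \<Rightarrow> ('a \<Rightarrow> 'a) \<Rightarrow> 'a set \<Rightarrow> bool" where
  "isolated_subset X T A \<longleftrightarrow> invariant_subset X T A \<and>
    (\<exists>U. closedin X U \<and> A \<subseteq> X interior_of U \<and> A = (\<Inter>n. iter X T n ` U))"

definition transitive :: "'a topology \<Rightarrow> ('a \<Rightarrow> 'a) \<Rightarrow> bool" where
  "transitive Y S \<longleftrightarrow>
    (\<forall>U V. openin Y U \<longrightarrow> U \<noteq> {} \<longrightarrow> openin Y V \<longrightarrow> V \<noteq> {} \<longrightarrow>
      (\<exists>i. U \<inter> iter Y S (- i) ` V \<noteq> {}))"

definition weakly_mixing :: "'a topology \<Rightarrow> ('a \<Rightarrow> 'a) \<Rightarrow> bool" where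
  "weakly_mixing Y S \<longleftrightarrow> transitive (prod_topology Y Y) (map_prod S S)"

text \<open>Points of the product topology on \<open>X\<^sup>X\<close> are functions that are \<open>undefined\<close> outside
  \<open>topspace X\<close>, hence the restrictions below.\<close>

definition enveloping_semigroup :: "'a topology \<Rightarrow> ('a \<Rightarrow> 'a) \<Rightarrow> ('a \<Rightarrow> 'a) topology" where
  "enveloping_semigroup X T =
    (let XX = product_topology (\<lambda>_. X) (topspace X)
     in subtopology XX (XX closure_of range (\<lambda>i. restrict (iter X T i) (topspace X))))"

definition enveloping_map :: "'a topology \<Rightarrow> ('a \<Rightarrow> 'a) \<Rightarrow> ('a \<Rightarrow> 'a) \<Rightarrow> ('a \<Rightarrow> 'a)" where
  "enveloping_map X T p = compose (topspace X) T p"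

end

theory Submission
  imports Defs
begin

text \<open>
  Throughout, \<open>(X, T)\<close> is a cascade whose enveloping semigroup \<open>E\<close> is weakly mixing. The powers of
  \<open>T\<close> are dense in \<open>E\<close>, so everything can be read off the topology \<open>\<tau>\<close> that \<open>E\<close> induces on the
  integers through \<open>i \<mapsto> T\<^sup>i\<close>. It has two properties. Evaluation at a point is continuous on \<open>E\<close>, so
  every orbit map \<open>i \<mapsto> T\<^sup>i x\<close> is continuous from \<open>\<tau>\<close> to \<open>X\<close>. And transitivity of \<open>E \<times> E\<close> says that
  for nonempty \<open>\<tau>\<close>-open sets \<open>P, Q, R, S\<close> a single translation carries some element of \<open>P\<close> into
  \<open>Q\<close> and some element of \<open>R\<close> into \<open>S\<close>. The flow on \<open>X \<times> X\<close> has these properties for the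
  same \<open>\<tau>\<close>.

  The heart of the proof is that in a compact flow with such a topology \<open>\<tau>\<close> every isolated closed
  invariant set \<open>A\<close>, with isolating neighbourhood \<open>U\<close>, is open (\<open>openin_isolated\<close>). There cannot be
  both a point outside \<open>A\<close> whose forward orbit stays in \<open>U\<close> and one whose backward orbit does:
  the times at which both orbits are outside \<open>U\<close>, after shifting one orbit so that there is such a
  time, would form a nonempty bounded open set, and \<open>\<tau>\<close> has none
  (\<open>not_forward_and_backward_trapped\<close>). Up to reversing time, all backward trapped points therefore lie
  in \<open>A\<close>, which makes \<open>A\<close> an attractor: by compactness it has a closed neighbourhood \<open>W\<close> mapped
  into itself. If an orbit met both the interior and the complement of \<open>W\<close>, then passing from the
  complement to the interior would force a positive time and passing back a negative one, whereas
  mixing offers one time for both. So every orbit through the interior of \<open>W\<close> stays in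
  \<open>W\<close> and hence lies in \<open>A\<close>, and \<open>A\<close> is a neighbourhood of itself
  (\<open>openin_if_attracting\<close>).

  For an isolated set in \<open>X\<close> this yields an invariant clopen set, which transitivity of \<open>X\<close> forces to
  be trivial. If instead \<open>B\<close> is any clopen set, let \<open>x \<sim> y\<close> mean that the orbits of \<open>x\<close> and \<open>y\<close> visit
  \<open>B\<close> at the same times. As a subset of \<open>X \<times> X\<close> this relation is the largest invariant subset of the
  clopen set of pairs not separated by \<open>B\<close>, hence open. So \<open>\<sim>\<close> is an invariant equivalence relation
  with open classes, and mixing moves the class of \<open>x\<close> at once to itself and to the class of \<open>T x\<close>,
  so \<open>x \<sim> T x\<close> (\<open>clopen_invariant\<close>). Every clopen set is thus invariant, and transitivity makes
  \<open>X\<close> connected.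
\<close>

section \<open>Integer flows whose orbit maps come from a mixing topology\<close>

text \<open>
  Pulling \<open>P, Q, R, S\<close> back from open sets of a cascade along a dense orbit, this becomes transitivity
  of the product of the cascade with itself, applied to \<open>P \<times> R\<close> and \<open>Q \<times> S\<close>; the times
  \<open>i\<close> and \<open>j\<close> replace the point of the product.
\<close>

definition mixing_int_topology :: "int topology \<Rightarrow> bool" where
  "mixing_int_topology \<tau> \<longleftrightarrow> topspace \<tau> = UNIV \<and>
    (\<forall>P Q R S. openin \<tau> P \<longrightarrow> openin \<tau> Q \<longrightarrow> openin \<tau> R \<longrightarrow> openin \<tau> S \<longrightarrow>
      P \<noteq> {} \<longrightarrow> Q \<noteq> {} \<longrightarrow> R \<noteq> {} \<longrightarrow> S \<noteq> {} \<longrightarrow>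
      (\<exists>n i j. i \<in> P \<and> i + n \<in> Q \<and> j \<in> R \<and> j + n \<in> S))"

lemma mixing_int_topologyD:
  assumes "mixing_int_topology \<tau>"
    and "openin \<tau> P" "openin \<tau> Q" "openin \<tau> R" "openin \<tau> S"
    and "p \<in> P" "q \<in> Q" "r \<in> R" "s \<in> S"
  obtains n i j where "i \<in> P" "i + n \<in> Q" "j \<in> R" "j + n \<in> S"
  using assms unfolding mixing_int_topology_def by (metis empty_iff)

locale int_flow =
  fixes Y :: "'b topology" and \<phi> :: "int \<Rightarrow> 'b \<Rightarrow> 'b"
  assumes compact: "compact_space Y"
    and flow_zero: "y \<in> topspace Y \<Longrightarrow> \<phi> 0 y = y"
    and flow_add: "y \<in> topspace Y \<Longrightarrow> \<phi> (i + j) y = \<phi> i (\<phi> j y)"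
    and continuous_flow: "continuous_map Y Y (\<phi> i)"
begin

lemma flow_in: "y \<in> topspace Y \<Longrightarrow> \<phi> i y \<in> topspace Y"
  using continuous_flow[of i] by (auto simp: continuous_map_def)

lemma openin_flow_preimage:
  assumes "openin Y V" shows "openin Y {y \<in> topspace Y. \<phi> i y \<in> V}"
  using continuous_flow assms by (rule openin_continuous_map_preimage)

lemma closedin_flow_preimage:
  assumes "closedin Y V" shows "closedin Y {y \<in> topspace Y. \<phi> i y \<in> V}"
  using continuous_flow assms by (rule closedin_continuous_map_preimage)

end

locale mixing_int_flow = int_flow +
  fixes \<tau> :: "int topology"
  assumes mixing: "mixing_int_topology \<tau>"
    and continuous_orbit: "y \<in> topspace Y \<Longrightarrow> continuous_map \<tau> Y (\<lambda>i. \<phi> i y)"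
begin

lemma openin_visit_times:
  assumes "y \<in> topspace Y" "openin Y V"
  shows "openin \<tau> {i. \<phi> i y \<in> V}"
  using openin_continuous_map_preimage[OF continuous_orbit[OF assms(1)] assms(2)] mixing
  by (simp add: mixing_int_topology_def)

lemma openin_escape_times:
  assumes "y \<in> topspace Y" "closedin Y U"
  shows "openin \<tau> {i. \<phi> i y \<notin> U}"
proof -
  have "{i. \<phi> i y \<notin> U} = {i. \<phi> i y \<in> topspace Y - U}"
    using flow_in[OF assms(1)] by auto
  then show ?thesis
    using openin_visit_times[OF assms(1), of "topspace Y - U"] assms(2) by auto
qed

text \<open>
  A nonempty open set of times cannot be bounded: its translates are open here because they
  come from shifted orbits, and mixing asks for one \<open>n\<close> that is both small, carrying the set to itself,
  and large, carrying it to a distant translate. The point \<open>y\<close> can leave \<open>U\<close> only at negative times and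
  \<open>z\<close> only at positive ones, so common escape times would be such a set.
\<close>

lemma not_forward_and_backward_trapped:
  assumes U: "closedin Y U"
    and y: "y \<in> topspace Y" "\<And>n. n \<ge> 0 \<Longrightarrow> \<phi> n y \<in> U" "\<phi> a y \<notin> U"
    and z: "z \<in> topspace Y" "\<And>n. n \<le> 0 \<Longrightarrow> \<phi> n z \<in> U" "\<phi> b z \<notin> U"
  shows False
proof -
  define L where "L = b - a"
  \<comment> \<open>The escape times of \<open>y\<close>, and those of \<open>z\<close> shifted so that \<open>b\<close> falls on \<open>a\<close>,
    both translated by \<open>k\<close>. They meet at \<open>a + k\<close>, within a window of width \<open>L\<close>.\<close>
  define F where "F k = {i. \<phi> i (\<phi> (- k) y) \<notin> U} \<inter> {i. \<phi> i (\<phi> (L - k) z) \<notin> U}" for k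
  have F_open: "openin \<tau> (F k)" for k
    unfolding F_def by (intro openin_Int openin_escape_times U flow_in y z)
  have F_iff: "i \<in> F k \<longleftrightarrow> \<phi> (i - k) y \<notin> U \<and> \<phi> (i + L - k) z \<notin> U" for i k
    using flow_add[OF y(1), of i "- k"] flow_add[OF z(1), of i "L - k"]
    by (simp add: F_def algebra_simps)
  have F_bounds: "k - L < i \<and> i < k" if "i \<in> F k" for i k
    using that y(2)[of "i - k"] z(2)[of "i + L - k"] unfolding F_iff by force
  have in_F: "a + k \<in> F k" for k
    using y(3) z(3) by (simp add: F_iff L_def)
  \<comment> \<open>The windows force \<open>\<bar>n\<bar> < L\<close> for a return to \<open>F 0\<close>, but \<open>n > L\<close> for reaching \<open>F (2 * L)\<close>.\<close>
  obtain n i j where "i \<in> F 0" "i + n \<in> F 0" "j \<in> F 0" "j + n \<in> F (2 * L)"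
    using mixing_int_topologyD[OF mixing F_open F_open F_open F_open in_F in_F in_F in_F]
    by metis
  then show False
    using F_bounds[of i 0] F_bounds[of "i + n" 0] F_bounds[of j 0] F_bounds[of "j + n" "2 * L"]
    by linarith
qed

text \<open>
  The hypothesis on backward orbits makes \<open>A\<close> an attractor. Entering a trapping region takes
  positive time and leaving it takes negative time, so in a mixing flow no orbit meets both the interior
  and the complement of a closed trapping region.
\<close>

lemma openin_if_attracting:
  assumes U: "closedin Y U"
    and A: "A = {y \<in> topspace Y. \<forall>n. \<phi> n y \<in> U}"
    and AU: "A \<subseteq> Y interior_of U"
    and attr: "{y \<in> topspace Y. \<forall>n\<le>0. \<phi> n y \<in> U} \<subseteq> A"
  shows "openin Y A"
proof -
  define C where "C n = {y \<in> topspace Y. \<phi> (- int n) y \<in> U}" for n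
  have C_closed: "closedin Y (C n)" for n
    unfolding C_def by (rule closedin_flow_preimage[OF U])
  define V where "V = {y \<in> topspace Y. \<phi> 1 y \<in> Y interior_of U}"
  have V_open: "openin Y V"
    unfolding V_def by (rule openin_flow_preimage) simp
  have A_flow: "\<phi> m y \<in> A" if "y \<in> A" for m y
    using that flow_in flow_add[of y _ m] unfolding A by (auto simp flip: flow_add)
  have "A \<subseteq> V"
    using A_flow AU unfolding V_def A by blast
  have inter: "(\<Inter>n. C n) \<subseteq> V"
  proof
    fix y assume y: "y \<in> (\<Inter>n. C n)"
    have "\<phi> n y \<in> U" if "n \<le> 0" for n
    proof -
      have "y \<in> C (nat (- n))" using y by blast
      with that show ?thesis by (simp add: C_def)
    qed
    moreover have "y \<in> topspace Y" using y unfolding C_def by blast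
    ultimately show "y \<in> V" using attr \<open>A \<subseteq> V\<close> by blast
  qed
  \<comment> \<open>By compactness, finitely many backward iterates in \<open>U\<close> ensure that the next forward one is, too.\<close>
  obtain N where N: "(\<Inter>n\<le>N. C n) \<subseteq> V"
  proof -
    have "\<exists>\<F>. finite \<F> \<and> \<F> \<subseteq> range (\<lambda>n. topspace Y - C n) \<and> topspace Y - V \<subseteq> \<Union>\<F>"
    proof (rule compactinD)
      show "compactin Y (topspace Y - V)"
        using compact V_open by (intro closedin_compact_space) auto
      show "topspace Y - V \<subseteq> \<Union> (range (\<lambda>n. topspace Y - C n))" using inter by blast
    qed (use C_closed in auto)
    then obtain I where I: "finite I" "topspace Y - V \<subseteq> (\<Union>n\<in>I. topspace Y - C n)"
      by (metis finite_subset_image)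
    then obtain N where "\<forall>n\<in>I. n \<le> N" using finite_nat_set_iff_bounded_le by blast
    moreover have "C 0 \<subseteq> topspace Y" by (auto simp: C_def)
    ultimately have "(\<Inter>n\<le>N. C n) \<subseteq> V" using I by blast
    then show thesis by (rule that)
  qed
  \<comment> \<open>\<open>W\<close> is the trapping region and the open set \<open>W'\<close> witnesses that it is a neighbourhood of \<open>A\<close>.\<close>
  define W where "W = (\<Inter>n\<le>N. C n)"
  define W' where "W' = (\<Inter>n\<le>N. {y \<in> topspace Y. \<phi> (- int n) y \<in> Y interior_of U})"
  have W_closed: "closedin Y W"
    unfolding W_def using C_closed by (intro closedin_INT) auto
  have W'_open: "openin Y W'"
    unfolding W'_def by (intro openin_INT2 openin_flow_preimage) auto
  have "W' \<subseteq> W"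
    unfolding W_def W'_def C_def using interior_of_subset[of Y U] by auto
  have W_step: "\<phi> 1 y \<in> W" if "y \<in> W" for y
  proof -
    have y: "y \<in> topspace Y" "\<And>n. n \<le> N \<Longrightarrow> \<phi> (- int n) y \<in> U"
      using that unfolding W_def C_def by auto
    have "\<phi> 1 y \<in> U"
      using that N interior_of_subset[of Y U] unfolding W_def V_def by blast
    have "\<phi> (- int n) (\<phi> 1 y) \<in> U" if "n \<le> N" for n
    proof (cases n)
      case 0
      then show ?thesis using \<open>\<phi> 1 y \<in> U\<close> flow_zero flow_in y(1) by simp
    next
      case (Suc m)
      then show ?thesis using y(2)[of m] that flow_add[OF y(1), of "- int n" 1] by simp
    qed
    then show ?thesis using flow_in[OF y(1)] unfolding W_def C_def by auto
  qed
  have W_forward: "\<phi> (int m) y \<in> W" if "y \<in> W" for m y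
  proof (induction m)
    case 0
    have "y \<in> topspace Y" using that closedin_subset[OF W_closed] by blast
    with that show ?case by (simp add: flow_zero)
  next
    case (Suc m)
    have "y \<in> topspace Y" using that closedin_subset[OF W_closed] by blast
    then show ?case using W_step[OF Suc] flow_add[of y 1 "int m"] by simp
  qed
  have "W' \<subseteq> A"
  proof (rule subsetI, rule ccontr)
    fix x assume x: "x \<in> W'" "x \<notin> A"
    have xY: "x \<in> topspace Y" using x(1) unfolding W'_def by auto
    obtain k where "k \<le> 0" "\<phi> k x \<notin> U" using x(2) xY attr by blast
    have "W \<subseteq> U"
      unfolding W_def C_def using flow_zero by force
    then have k: "\<phi> k x \<notin> W" using \<open>\<phi> k x \<notin> U\<close> by blast
    have 0: "\<phi> 0 x \<in> W'" using x xY flow_zero by simp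
    have forward: "\<phi> j x \<in> W" if "\<phi> i x \<in> W'" "i \<le> j" for i j
      using W_forward[of "\<phi> i x" "nat (j - i)"] that \<open>W' \<subseteq> W\<close> flow_add[OF xY, of "j - i" i]
      by auto
    have k: "k \<in> {i. \<phi> i x \<notin> W}" and 0: "0 \<in> {i. \<phi> i x \<in> W'}" using k 0 by simp_all
    \<comment> \<open>Being outside \<open>W\<close> and then in \<open>W'\<close> needs \<open>n > 0\<close>, the converse needs \<open>n < 0\<close>.\<close>
    note escape = openin_escape_times[OF xY W_closed] and visit = openin_visit_times[OF xY W'_open]
    show False
    proof (rule mixing_int_topologyD[OF mixing escape visit visit escape k 0 0 k])
      fix n i j
      assume "i \<in> {i. \<phi> i x \<notin> W}" "i + n \<in> {i. \<phi> i x \<in> W'}"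
        "j \<in> {i. \<phi> i x \<in> W'}" "j + n \<in> {i. \<phi> i x \<notin> W}"
      then show False
        using forward[of "i + n" i] forward[of j "j + n"] by (cases "n \<ge> 0") auto
    qed
  qed
  moreover have "A \<subseteq> W'"
    using A_flow AU unfolding W'_def A by blast
  ultimately show ?thesis using W'_open by simp
qed

text \<open>Time reversal turns repellers into attractors, so only attractors need an argument.\<close>

lemma reversed: "mixing_int_flow Y (\<lambda>i. \<phi> (- i)) (pullback_topology UNIV uminus \<tau>)"
proof unfold_locales
  have top: "topspace \<tau> = UNIV" using mixing by (simp add: mixing_int_topology_def)
  have ex: "\<exists>n i j. - i \<in> P \<and> - (i + n) \<in> Q \<and> - j \<in> R \<and> - (j + n) \<in> S"
    if *: "openin \<tau> P" "openin \<tau> Q" "openin \<tau> R" "openin \<tau> S"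
      "p \<in> P" "q \<in> Q" "r \<in> R" "s \<in> S" for P Q R S p q r s
  proof -
    obtain n i j where "i \<in> P" "i + n \<in> Q" "j \<in> R" "j + n \<in> S"
      using mixing_int_topologyD[OF mixing *] by metis
    then show ?thesis
      by - (rule exI[of _ "- n"], rule exI[of _ "- i"], rule exI[of _ "- j"], simp add: add.commute)
  qed
  show "mixing_int_topology (pullback_topology UNIV uminus \<tau>)"
    unfolding mixing_int_topology_def
  proof (intro conjI allI impI)
    show "topspace (pullback_topology UNIV uminus \<tau>) = UNIV"
      by (simp add: topspace_pullback_topology top)
  next
    fix P Q R S
    assume "openin (pullback_topology UNIV uminus \<tau>) P" "openin (pullback_topology UNIV uminus \<tau>) Q"
      "openin (pullback_topology UNIV uminus \<tau>) R" "openin (pullback_topology UNIV uminus \<tau>) S"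
      and ne: "P \<noteq> {}" "Q \<noteq> {}" "R \<noteq> {}" "S \<noteq> {}"
    then obtain P' Q' R' S' where o: "openin \<tau> P'" "openin \<tau> Q'" "openin \<tau> R'" "openin \<tau> S'"
      and eq: "P = uminus -` P'" "Q = uminus -` Q'" "R = uminus -` R'" "S = uminus -` S'"
      by (auto simp: openin_pullback_topology)
    obtain p q r s where "p \<in> P'" "q \<in> Q'" "r \<in> R'" "s \<in> S'"
      using ne unfolding eq by blast
    from ex[OF o this] show "\<exists>n i j. i \<in> P \<and> i + n \<in> Q \<and> j \<in> R \<and> j + n \<in> S"
      unfolding eq by auto
  qed
  show "continuous_map (pullback_topology UNIV uminus \<tau>) Y (\<lambda>i. \<phi> (- i) y)"
    if "y \<in> topspace Y" for y
    using continuous_map_pullback[OF continuous_orbit[OF that], of UNIV uminus] by (simp add: o_def)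
  show "\<phi> (- (i + j)) y = \<phi> (- i) (\<phi> (- j) y)" if "y \<in> topspace Y" for y i j
    using flow_add[OF that, of "- i" "- j"] by simp
qed (simp_all add: compact flow_zero continuous_flow)

text \<open>
  Here \<open>A\<close> is the largest invariant subset of \<open>U\<close>. If it caught neither all backward nor all forward
  trapped points, there would be two points as excluded above; so it is an attractor or a repeller.
\<close>

theorem openin_isolated:
  assumes U: "closedin Y U"
    and A: "A = {y \<in> topspace Y. \<forall>n. \<phi> n y \<in> U}"
    and AU: "A \<subseteq> Y interior_of U"
  shows "openin Y A"
proof -
  interpret rev: mixing_int_flow Y "\<lambda>i. \<phi> (- i)" "pullback_topology UNIV uminus \<tau>"
    by (rule reversed)
  consider "{y \<in> topspace Y. \<forall>n\<le>0. \<phi> n y \<in> U} \<subseteq> A"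
    | "{y \<in> topspace Y. \<forall>n\<ge>0. \<phi> n y \<in> U} \<subseteq> A"
    using not_forward_and_backward_trapped[OF U] unfolding A by blast
  then show ?thesis
  proof cases
    case 1
    then show ?thesis by (rule openin_if_attracting[OF U A AU])
  next
    case 2
    have all: "(\<forall>n. P (- n)) \<longleftrightarrow> (\<forall>n. P n)" "(\<forall>n\<le>0. P (- n)) \<longleftrightarrow> (\<forall>n\<ge>0. P n)"
      for P :: "int \<Rightarrow> bool"
      by (metis minus_minus) (metis minus_minus neg_le_0_iff_le neg_0_le_iff_le)
    show ?thesis
      by (rule rev.openin_if_attracting[OF U _ AU])
        (use 2 A in \<open>simp_all add: all(1)[of "\<lambda>n. \<phi> n _ \<in> U"] all(2)[of "\<lambda>n. \<phi> n _ \<in> U"]\<close>)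
  qed
qed

end


section \<open>Clopen sets in mixing flows\<close>

lemma int_flow_prod:
  assumes "int_flow Y \<phi>" "int_flow Z \<psi>"
  shows "int_flow (prod_topology Y Z) (\<lambda>i. map_prod (\<phi> i) (\<psi> i))"
proof -
  interpret Y: int_flow Y \<phi> by fact
  interpret Z: int_flow Z \<psi> by fact
  show ?thesis
  proof
    show "compact_space (prod_topology Y Z)"
      using Y.compact Z.compact by (simp add: compact_space_prod_topology)
    show "continuous_map (prod_topology Y Z) (prod_topology Y Z) (map_prod (\<phi> i) (\<psi> i))" for i
      unfolding map_prod_def case_prod_unfold continuous_map_pairwise o_def
      using continuous_map_compose[OF continuous_map_fst Y.continuous_flow, of Z i]
        continuous_map_compose[OF continuous_map_snd Z.continuous_flow, of Y i]
      by (simp add: o_def)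
  qed (auto simp: Y.flow_zero Z.flow_zero Y.flow_add Z.flow_add)
qed

text \<open>
  The same topology \<open>\<tau>\<close> serves both flows. This is how the strength of the hypothesis on the
  enveloping semigroup, rather than on the space, enters.
\<close>

lemma mixing_int_flow_square:
  assumes "mixing_int_flow Y \<phi> \<tau>"
  shows "mixing_int_flow (prod_topology Y Y) (\<lambda>i. map_prod (\<phi> i) (\<phi> i)) \<tau>"
proof -
  interpret mixing_int_flow Y \<phi> \<tau> by fact
  show ?thesis
  proof (intro mixing_int_flow.intro mixing_int_flow_axioms.intro int_flow_prod mixing)
    fix y assume "y \<in> topspace (prod_topology Y Y)"
    then show "continuous_map \<tau> (prod_topology Y Y) (\<lambda>i. map_prod (\<phi> i) (\<phi> i) y)"
      by (cases y) (auto simp: continuous_map_pairwise o_def continuous_orbit)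
  qed unfold_locales
qed

text \<open>
  Having the same itinerary with respect to \<open>B\<close> is an isolated relation, so it is open by
  \<open>openin_isolated\<close>. Its classes are then permuted by the flow, and mixing identifies the class of
  \<open>\<phi> 1 x\<close> with that of \<open>x\<close>.
\<close>

lemma (in mixing_int_flow) clopen_invariant:
  assumes B: "openin Y B" "closedin Y B" and x: "x \<in> topspace Y"
  shows "\<phi> 1 x \<in> B \<longleftrightarrow> x \<in> B"
proof -
  interpret sq: mixing_int_flow "prod_topology Y Y" "\<lambda>i. map_prod (\<phi> i) (\<phi> i)" \<tau>
    by (rule mixing_int_flow_square) unfold_locales
  define U where "U = B \<times> B \<union> (topspace Y - B) \<times> (topspace Y - B)"
  define A where "A = {y \<in> topspace (prod_topology Y Y). \<forall>n. map_prod (\<phi> n) (\<phi> n) y \<in> U}"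
  have U: "openin (prod_topology Y Y) U" "closedin (prod_topology Y Y) U"
    unfolding U_def using B openin_diff[OF openin_topspace B(2)] closedin_diff[OF closedin_topspace B(1)]
    by (simp_all add: openin_Un closedin_Un openin_prod_Times_iff closedin_prod_Times_iff)
  have A_sub: "A \<subseteq> prod_topology Y Y interior_of U"
  proof -
    have "y \<in> U" if "y \<in> A" for y
      using that sq.flow_zero[of y] unfolding A_def by (metis (mono_tags, lifting) mem_Collect_eq)
    then show ?thesis using U(1) by (auto simp: interior_of_openin)
  qed
  have A_open: "openin (prod_topology Y Y) A"
    by (rule sq.openin_isolated[OF U(2) A_def A_sub])
  have A_iff: "(y, z) \<in> A \<longleftrightarrow> (\<forall>n. \<phi> n y \<in> B \<longleftrightarrow> \<phi> n z \<in> B)"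
    if "y \<in> topspace Y" "z \<in> topspace Y" for y z
    using that flow_in unfolding A_def U_def by auto
  have visits: "openin \<tau> {i. (\<phi> i x, z) \<in> A}" if "z \<in> topspace Y" for z
  proof -
    have "continuous_map \<tau> (prod_topology Y Y) (\<lambda>i. (\<phi> i x, z))"
      using that x by (simp add: continuous_map_pairwise o_def continuous_orbit)
    from openin_continuous_map_preimage[OF this A_open] show ?thesis
      using mixing by (simp add: mixing_int_topology_def)
  qed
  have start: "0 \<in> {i. (\<phi> i x, x) \<in> A}" "1 \<in> {i. (\<phi> i x, \<phi> 1 x) \<in> A}"
    using x flow_in by (auto simp: A_iff flow_zero)
  obtain n i j where "i \<in> {i. (\<phi> i x, x) \<in> A}" "i + n \<in> {i. (\<phi> i x, x) \<in> A}"
      "j \<in> {i. (\<phi> i x, x) \<in> A}" "j + n \<in> {i. (\<phi> i x, \<phi> 1 x) \<in> A}"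
    by (rule mixing_int_topologyD[OF mixing visits[OF x] visits[OF x] visits[OF x]
          visits[OF flow_in[OF x]] start(1) start(1) start(1) start(2)])
  \<comment> \<open>Write \<open>\<sim>\<close> for membership in \<open>A\<close>. From \<open>i\<close> one gets \<open>\<phi> n x \<sim> x\<close>, from \<open>j\<close> one gets
    \<open>\<phi> n x \<sim> \<phi> 1 x\<close>.\<close>
  then have eq: "\<phi> k (\<phi> i x) \<in> B \<longleftrightarrow> \<phi> k x \<in> B" "\<phi> k (\<phi> (i + n) x) \<in> B \<longleftrightarrow> \<phi> k x \<in> B"
    "\<phi> k (\<phi> j x) \<in> B \<longleftrightarrow> \<phi> k x \<in> B" "\<phi> k (\<phi> (j + n) x) \<in> B \<longleftrightarrow> \<phi> k (\<phi> 1 x) \<in> B" for k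
    using x flow_in by (auto simp: A_iff)
  have "x \<in> B \<longleftrightarrow> \<phi> n x \<in> B"
    using eq(1)[of n] eq(2)[of 0] flow_add[OF x, of n i] flow_zero x flow_in
    by (simp add: add.commute)
  also have "\<dots> \<longleftrightarrow> \<phi> 1 x \<in> B"
    using eq(3)[of n] eq(4)[of 0] flow_add[OF x, of n j] flow_zero x flow_in
    by (simp add: add.commute)
  finally show ?thesis by simp
qed


section \<open>The flow of a cascade\<close>

lemma cascade_bij_betw:
  assumes "cascade X T" shows "bij_betw T (topspace X) (topspace X)"
  using assms by (auto simp: cascade_def bij_betw_def homeomorphic_eq_everything_map)

lemma iter_in:
  assumes "bij_betw T (topspace X) (topspace X)" "x \<in> topspace X"
  shows "iter X T i x \<in> topspace X"
proof -
  have "f ` topspace X \<subseteq> topspace X \<Longrightarrow> (f ^^ n) x \<in> topspace X" for f :: "'a \<Rightarrow> 'a" and n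
    using assms(2) by (induction n) auto
  then show ?thesis
    using bij_betw_imp_surj_on[OF assms(1)]
      bij_betw_imp_surj_on[OF bij_betw_inv_into[OF assms(1)]]
    unfolding iter_def by auto
qed

lemma iter_succ:
  assumes T: "bij_betw T (topspace X) (topspace X)" and x: "x \<in> topspace X"
  shows "iter X T (i + 1) x = T (iter X T i x)"
proof (cases "0 \<le> i")
  case True
  then show ?thesis by (simp add: iter_def nat_add_distrib)
next
  case False
  define m where "m = nat (- (i + 1))"
  have i: "i = - int (Suc m)" using False by (simp add: m_def)
  have iter: "iter X T (i + 1) x = (inv_into (topspace X) T ^^ m) x"
    unfolding i by (simp add: iter_def)
  then have "(inv_into (topspace X) T ^^ m) x \<in> T ` topspace X"
    using iter_in[OF T x, of "i + 1"] bij_betw_imp_surj_on[OF T] by simp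
  then show ?thesis
    unfolding iter by (simp add: i iter_def f_inv_into_f nat_add_distrib)
qed

lemma iter_add:
  assumes T: "bij_betw T (topspace X) (topspace X)" and x: "x \<in> topspace X"
  shows "iter X T (i + j) x = iter X T i (iter X T j x)"
proof (induction i rule: int_induct[where k = 0])
  case base
  then show ?case by (simp add: iter_def)
next
  case (step1 i)
  then show ?case
    using iter_succ[OF T x, of "i + j"] iter_succ[OF T iter_in[OF T x], of i j]
    by (simp add: algebra_simps)
next
  case (step2 i)
  have "T (iter X T (i - 1 + j) x) = T (iter X T (i - 1) (iter X T j x))"
    using step2 iter_succ[OF T x, of "i - 1 + j"] iter_succ[OF T iter_in[OF T x], of "i - 1" j]
    by (simp add: algebra_simps)
  then show ?case
    using bij_betw_imp_inj_on[OF T] iter_in[OF T] x by (meson inj_onD)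
qed

lemma continuous_map_iter:
  assumes "homeomorphic_map X X T"
  shows "continuous_map X X (iter X T i)"
proof -
  have pow: "continuous_map X X (f ^^ n)" if "continuous_map X X f" for f :: "'a \<Rightarrow> 'a" and n
    by (induction n) (use that continuous_map_compose in \<open>simp_all only: funpow.simps continuous_map_id, blast\<close>)
  obtain g where g: "homeomorphic_maps X X T g"
    using assms homeomorphic_map_maps by blast
  have "inj_on T (topspace X)"
    using assms by (simp add: homeomorphic_eq_everything_map)
  then have "g x = inv_into (topspace X) T x" if "x \<in> topspace X" for x
    using g that unfolding homeomorphic_maps_def continuous_map_def
    by (metis inv_into_f_f PiE)
  then have "continuous_map X X (inv_into (topspace X) T)"
    using g continuous_map_eq unfolding homeomorphic_maps_def by blast
  then show ?thesis
    using pow[OF homeomorphic_imp_continuous_map[OF assms]] pow[of "inv_into (topspace X) T"]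
    unfolding iter_def by simp
qed

lemma int_flow_iter:
  assumes "cascade X T" shows "int_flow X (iter X T)"
proof
  show "compact_space X" using assms by (simp add: cascade_def)
  show "continuous_map X X (iter X T i)" for i
    using assms continuous_map_iter by (auto simp: cascade_def)
qed (use iter_add[OF cascade_bij_betw[OF assms]] in \<open>auto simp: iter_def\<close>)

lemma transitive_clopen_trivial:
  assumes X: "cascade X T" "transitive X T"
    and B: "openin X B" "closedin X B" "B \<noteq> {}" "B \<noteq> topspace X"
    and inv: "\<And>i x. x \<in> topspace X \<Longrightarrow> iter X T i x \<in> B \<Longrightarrow> x \<in> B"
  shows False
proof -
  have "openin X (topspace X - B)" "topspace X - B \<noteq> {}"
    using B closedin_subset by blast+
  then obtain i where "B \<inter> iter X T (- i) ` (topspace X - B) \<noteq> {}"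
    using X(2) B unfolding transitive_def by blast
  then show False using inv by blast
qed


section \<open>The topology on the integers induced by the enveloping semigroup\<close>

lemma homeomorphic_map_compose_product:
  assumes "homeomorphic_map X X T"
  shows "homeomorphic_map (product_topology (\<lambda>_. X) I) (product_topology (\<lambda>_. X) I) (compose I T)"
proof -
  have cont: "continuous_map (product_topology (\<lambda>_. X) I) (product_topology (\<lambda>_. X) I) (compose I f)"
    if f: "continuous_map X X f" for f
  proof -
    have "continuous_map (product_topology (\<lambda>_. X) I) X (\<lambda>p. f (p k))" if "k \<in> I" for k
      using continuous_map_compose[OF continuous_map_product_projection[OF that] f]
      by (simp add: o_def)
    then show ?thesis
      by (auto simp: continuous_map_componentwise compose_def)
  qed
  obtain g where g: "homeomorphic_maps X X T g"
    using assms homeomorphic_map_maps by blast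
  have "homeomorphic_maps (product_topology (\<lambda>_. X) I) (product_topology (\<lambda>_. X) I)
      (compose I T) (compose I g)"
    using g cont unfolding homeomorphic_maps_def
    by (auto simp: compose_def fun_eq_iff PiE_iff extensional_def)
  then show ?thesis using homeomorphic_map_maps by blast
qed

text \<open>
  Negative exponents can be avoided by exchanging the two sets, provided that the inverse chosen by
  \<open>iter\<close> is at least a right inverse, which is what surjectivity gives.
\<close>

lemma transitive_funpow:
  assumes "transitive Y f" "f ` topspace Y = topspace Y"
    and U: "openin Y U" "U \<noteq> {}" and V: "openin Y V" "V \<noteq> {}"
  obtains m u where "u \<in> U" "(f ^^ m) u \<in> V" | m v where "v \<in> V" "(f ^^ m) v \<in> U"
proof -
  obtain i v where v: "v \<in> V" "iter Y f (- i) v \<in> U"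
    using assms unfolding transitive_def by blast
  show thesis
  proof (cases "0 \<le> - i")
    case True
    then show thesis using v that(2) by (simp add: iter_def)
  next
    case False
    define g where "g = inv_into (topspace Y) f"
    have "(g ^^ m) v \<in> topspace Y \<and> (f ^^ m) ((g ^^ m) v) = v" for m
    proof (induction m)
      case 0
      then show ?case using v(1) openin_subset[OF V(1)] by auto
    next
      case (Suc m)
      then have "(g ^^ m) v \<in> f ` topspace Y" using assms(2) by simp
      then have "g ((g ^^ m) v) \<in> topspace Y" "f (g ((g ^^ m) v)) = (g ^^ m) v"
        unfolding g_def by (simp_all add: inv_into_into f_inv_into_f)
      then show ?case using Suc by (simp add: funpow_swap1)
    qed
    then show thesis using v that(1)[of "iter Y f (- i) v" "nat i"] False
      by (simp add: iter_def g_def)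
  qed
qed

text \<open>
  Transitivity of \<open>E \<times> E\<close> yields points \<open>u\<close>, \<open>v\<close> of \<open>E\<close> and a common time. The conditions on \<open>u\<close> and on
  \<open>v\<close> are open and independent of each other, so by density each point can be replaced by a power of
  \<open>T\<close>, generally by different ones.
\<close>

lemma mixing_envelope_topology:
  fixes X :: "'a topology"
  assumes X: "cascade X T"
    and wm: "weakly_mixing (enveloping_semigroup X T) (enveloping_map X T)"
  shows "mixing_int_topology (pullback_topology UNIV (\<lambda>i. restrict (iter X T i) (topspace X))
    (product_topology (\<lambda>_. X) (topspace X)))"
proof -
  interpret int_flow X "iter X T" using X by (rule int_flow_iter)
  define XX where "XX = product_topology (\<lambda>_. X) (topspace X)"
  define t where "t = (\<lambda>i. restrict (iter X T i) (topspace X))"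
  define C where "C = compose (topspace X) T"
  define E where "E = XX closure_of range t"
  have T: "bij_betw T (topspace X) (topspace X)" using X by (rule cascade_bij_betw)
  have hC: "homeomorphic_map XX XX C"
    using X homeomorphic_map_compose_product unfolding cascade_def XX_def C_def by blast
  have t_in: "range t \<subseteq> topspace XX" using flow_in by (auto simp: t_def XX_def)
  have t_step: "C (t i) = t (i + 1)" for i
    using iter_succ[OF T] by (auto simp: t_def C_def compose_def fun_eq_iff)
  have pow_t: "(C ^^ m) (t i) = t (i + int m)" for m i
    by (induction m) (auto simp: t_step algebra_simps)
  have "C ` range t = range t"
  proof -
    have "t i \<in> C ` range t" for i
      using t_step[of "i - 1"] by (intro image_eqI[of _ _ "t (i - 1)"]) auto
    then show ?thesis by (auto simp: t_step)
  qed
  then have C_E: "C ` E = E"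
    using homeomorphic_map_closure_of[OF hC t_in] by (simp add: E_def)
  have E_sub: "E \<subseteq> topspace XX" by (simp add: E_def closure_of_subset_topspace)
  have env: "enveloping_semigroup X T = subtopology XX E" "enveloping_map X T = C"
    by (simp_all add: enveloping_semigroup_def E_def enveloping_map_def fun_eq_iff Let_def XX_def t_def C_def)
  have top_env: "topspace (subtopology XX E) = E" using E_sub by auto
  have pow_cont: "continuous_map XX XX (C ^^ m)" for m
    by (induction m)
      (use homeomorphic_imp_continuous_map[OF hC] continuous_map_compose in
        \<open>simp_all only: funpow.simps continuous_map_id, blast\<close>)
  have dense: "\<exists>i. t i \<in> G \<and> t (i + int m) \<in> H"
    if "p \<in> E" "p \<in> G" "(C ^^ m) p \<in> H" "openin XX G" "openin XX H" for p G H m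
  proof -
    define W where "W = G \<inter> {p \<in> topspace XX. (C ^^ m) p \<in> H}"
    have "openin XX W"
      unfolding W_def using that(4,5) openin_continuous_map_preimage[OF pow_cont] by blast
    moreover have "p \<in> W"
      using that E_sub unfolding W_def by blast
    moreover have "\<forall>V. p \<in> V \<and> openin XX V \<longrightarrow> (\<exists>y. y \<in> range t \<and> y \<in> V)"
      using that(1) unfolding E_def in_closure_of by simp
    ultimately obtain i where "t i \<in> W" by blast
    then show ?thesis using pow_t[of m i] unfolding W_def by auto
  qed
  have key: "\<exists>n i j. t i \<in> P \<and> t (i + n) \<in> Q \<and> t j \<in> R \<and> t (j + n) \<in> S"
    if o: "openin XX P" "openin XX Q" "openin XX R" "openin XX S"
      and ne: "t p \<in> P" "t q \<in> Q" "t r \<in> R" "t s \<in> S" for P Q R S p q r s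
  proof -
    let ?EE = "prod_topology (subtopology XX E) (subtopology XX E)"
    have tE: "t i \<in> E" for i using closure_of_subset[OF t_in] by (auto simp: E_def)
    have tr: "transitive ?EE (map_prod C C)"
      using wm by (simp add: weakly_mixing_def env)
    have surj: "map_prod C C ` topspace ?EE = topspace ?EE"
      unfolding topspace_prod_topology top_env using map_prod_surj_on C_E by blast
    have pow: "(map_prod C C ^^ m) (u, v) = ((C ^^ m) u, (C ^^ m) v)" for m u v
      by (induction m) auto
    have openEE: "openin ?EE ((E \<inter> G) \<times> (E \<inter> H))" if "openin XX G" "openin XX H" for G H
      using that by (simp add: openin_prod_Times_iff openin_subtopology_Int2)
    have neEE: "(E \<inter> G) \<times> (E \<inter> H) \<noteq> {}" if "t a \<in> G" "t b \<in> H" for G H a b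
      using that tE by blast
    show ?thesis
    proof (rule transitive_funpow[OF tr surj openEE[OF o(1,3)] neEE[OF ne(1,3)]
            openEE[OF o(2,4)] neEE[OF ne(2,4)]])
      fix m w assume "w \<in> (E \<inter> P) \<times> (E \<inter> R)" "(map_prod C C ^^ m) w \<in> (E \<inter> Q) \<times> (E \<inter> S)"
      then obtain u v where "u \<in> E" "u \<in> P" "v \<in> E" "v \<in> R" "(C ^^ m) u \<in> Q" "(C ^^ m) v \<in> S"
        by (cases w) (auto simp: pow)
      with dense[of u P m Q] dense[of v R m S] o show ?thesis by meson
    next
      fix m w assume "w \<in> (E \<inter> Q) \<times> (E \<inter> S)" "(map_prod C C ^^ m) w \<in> (E \<inter> P) \<times> (E \<inter> R)"
      then obtain u v where "u \<in> E" "u \<in> Q" "v \<in> E" "v \<in> S" "(C ^^ m) u \<in> P" "(C ^^ m) v \<in> R"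
        by (cases w) (auto simp: pow)
      with dense[of u Q m P] dense[of v S m R] o obtain i j
        where ij: "t i \<in> Q" "t (i + int m) \<in> P" "t j \<in> S" "t (j + int m) \<in> R" by meson
      \<comment> \<open>The sets were exchanged, so the translation is by \<open>- m\<close> and starts at the shifted times.\<close>
      show ?thesis
        by (rule exI[of _ "- int m"], rule exI[of _ "i + int m"], rule exI[of _ "j + int m"])
          (use ij in simp)
    qed
  qed
  show ?thesis
    unfolding mixing_int_topology_def XX_def[symmetric] t_def[symmetric]
  proof (intro conjI allI impI)
    show "topspace (pullback_topology UNIV t XX) = UNIV"
      using t_in by (auto simp: topspace_pullback_topology)
  next
    fix P Q R S
    assume "openin (pullback_topology UNIV t XX) P" "openin (pullback_topology UNIV t XX) Q"
      "openin (pullback_topology UNIV t XX) R" "openin (pullback_topology UNIV t XX) S"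
      and ne: "P \<noteq> {}" "Q \<noteq> {}" "R \<noteq> {}" "S \<noteq> {}"
    then obtain P' Q' R' S' where o: "openin XX P'" "openin XX Q'" "openin XX R'" "openin XX S'"
      and eq: "P = t -` P'" "Q = t -` Q'" "R = t -` R'" "S = t -` S'"
      by (auto simp: openin_pullback_topology)
    obtain p q r s where "t p \<in> P'" "t q \<in> Q'" "t r \<in> R'" "t s \<in> S'"
      using ne unfolding eq by blast
    from key[OF o this] show "\<exists>n i j. i \<in> P \<and> i + n \<in> Q \<and> j \<in> R \<and> j + n \<in> S"
      unfolding eq by auto
  qed
qed

lemma continuous_orbit_envelope_topology:
  assumes "x \<in> topspace X"
  shows "continuous_map (pullback_topology UNIV (\<lambda>i. restrict (iter X T i) (topspace X))
    (product_topology (\<lambda>_. X) (topspace X))) X (\<lambda>i. iter X T i x)"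
  using continuous_map_pullback[OF continuous_map_product_projection[OF assms, of "\<lambda>_. X"],
      of UNIV "\<lambda>i. restrict (iter X T i) (topspace X)"] assms
  by (simp add: o_def)

lemma mixing_int_flow_iter:
  assumes "cascade X T" "weakly_mixing (enveloping_semigroup X T) (enveloping_map X T)"
  shows "mixing_int_flow X (iter X T) (pullback_topology UNIV
    (\<lambda>i. restrict (iter X T i) (topspace X)) (product_topology (\<lambda>_. X) (topspace X)))"
  by (intro mixing_int_flow.intro mixing_int_flow_axioms.intro int_flow_iter
      mixing_envelope_topology continuous_orbit_envelope_topology assms)


section \<open>Cascades whose enveloping semigroup is weakly mixing\<close>

theorem corollary3p4:
  fixes X :: "'a topology" and T :: "'a \<Rightarrow> 'a"
  assumes "cascade X T" and "transitive X T"
  shows "(\<not> connected_space X \<longrightarrow>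
            \<not> weakly_mixing (enveloping_semigroup X T) (enveloping_map X T)) \<and>
         ((\<exists>A. A \<noteq> {} \<and> A \<noteq> topspace X \<and> closedin X A \<and> invariant_subset X T A \<and>
              isolated_subset X T A) \<longrightarrow>
            \<not> weakly_mixing (enveloping_semigroup X T) (enveloping_map X T))"
proof (cases "weakly_mixing (enveloping_semigroup X T) (enveloping_map X T)")
  case True
  interpret mixing_int_flow X "iter X T" "pullback_topology UNIV
      (\<lambda>i. restrict (iter X T i) (topspace X)) (product_topology (\<lambda>_. X) (topspace X))"
    using assms(1) True by (rule mixing_int_flow_iter)
  have "connected_space X"
    unfolding connected_space_clopen_in
  proof (intro allI impI, rule ccontr)
    fix B assume B: "openin X B \<and> closedin X B" "\<not> (B = {} \<or> B = topspace X)"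
    have inv: "iter X T i x \<in> B \<longleftrightarrow> x \<in> B" if x: "x \<in> topspace X" for i x
    proof (induction i rule: int_induct[where k = 0])
      case base
      then show ?case using flow_zero x by simp
    next
      case (step1 i)
      then show ?case
        using clopen_invariant[of B "iter X T i x"] flow_in flow_add[OF x, of 1 i] B x
        by (simp add: add.commute)
    next
      case (step2 i)
      then show ?case
        using clopen_invariant[of B "iter X T (i - 1) x"] flow_in flow_add[OF x, of 1 "i - 1"] B x
        by simp
    qed
    show False
      by (rule transitive_clopen_trivial[OF assms, of B]) (use B inv in auto)
  qed
  moreover have False if A: "A \<noteq> {}" "A \<noteq> topspace X" "closedin X A" "isolated_subset X T A" for A
  proof -
    obtain U where U: "closedin X U" "A \<subseteq> X interior_of U" "A = (\<Inter>n. iter X T n ` U)"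
      using A(4) unfolding isolated_subset_def by blast
    have cancel: "iter X T i (iter X T (- i) x) = x" if "x \<in> topspace X" for i x
      using flow_add[OF that, of i "- i"] flow_zero[OF that] by simp
    have img: "x \<in> iter X T n ` U \<longleftrightarrow> iter X T (- n) x \<in> U" if "x \<in> topspace X" for x n
      using cancel[of _ "- n"] cancel[OF that, of n] closedin_subset[OF U(1)]
      by (auto simp: image_iff) (metis)+
    \<comment> \<open>Membership in all images of \<open>U\<close> becomes membership of the whole orbit in \<open>U\<close>.\<close>
    have eq: "A = {x \<in> topspace X. \<forall>n. iter X T n x \<in> U}"
    proof -
      have "x \<in> A \<longleftrightarrow> (\<forall>n. iter X T n x \<in> U)" if "x \<in> topspace X" for x
        unfolding U(3) using img[OF that] by (auto) (metis minus_minus)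
      then show ?thesis using closedin_subset[OF A(3)] by blast
    qed
    have inv: "x \<in> A" if x: "x \<in> topspace X" and "iter X T i x \<in> A" for i x
    proof -
      have "iter X T n x \<in> U" for n
        using that flow_add[OF x, of "n - i" i] unfolding eq by auto
      then show ?thesis using x unfolding eq by blast
    qed
    show False
      by (rule transitive_clopen_trivial[OF assms openin_isolated[OF U(1) eq U(2)] A(3,1,2) inv])
  qed
  ultimately show ?thesis by blast
qed simp

end
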